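(* Let $\Phi,\Psi$ be assertions over $\bigcup_{i=1}^{k+l}\mathcal{V}_i$, let $\mathbb{P}_1,\dots,\mathbb{P}_{k+l}$ be programs with $\mathbb{P}_i$ over $\mathcal{V}_i$, and let $(\Xi,\mathcal{C})$ be a parametric postcondition for $(\Phi,\mathbb{P}_1,\dots,\mathbb{P}_{k+l})$. If the closed formula $$\forall_{x\in\mathcal{V}_1\cup\cdots\cup\mathcal{V}_k}x.\ \exists_{\mu\in\mathfrak{P}}\mu.\ \Big(\mathcal{C}\wedge\forall_{x\in\mathcal{V}_{k+1}\cup\cdots\cup\mathcal{V}_{k+l}}x.\ (\Xi\Rightarrow\Psi)\Big)$$ holds, then the Forall-Exist Hoare Tuple $\langle\Phi\rangle\,\mathbb{P}_1\circledast\cdots\circledast\mathbb{P}_k\sim\mathbb{P}_{k+1}\circledast\cdots\circledast\mathbb{P}_{k+l}\,\langle\Psi\rangle$ is valid.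
   Context: Programs. Fix a set $\mathcal{V}$ of program variables. Programs are generated by $\mathbb{P},\mathbb{Q} ::= \mathtt{skip} \mid x := e \mid \mathtt{assume}(b) \mid \mathtt{if}(b,\mathbb{P},\mathbb{Q}) \mid \mathtt{while}(b,\mathbb{P}) \mid \mathbb{P};\mathbb{Q} \mid x := \star$, with $x\in\mathcal{V}$, $e$ a deterministic integer arithmetic expression and $b$ a deterministic Boolean expression. States are maps $\sigma:\mathcal{V}\to\mathbb{Z}$, and $[\![\mathbb{P}]\!](\sigma,\sigma')$ (standard big-step semantics) means $\mathbb{P}$, executed from $\sigma$, can terminate in $\sigma'$; here $x:=\star$ assigns an arbitrary integer to $x$, $\mathtt{assume}(b)$ continues only from states satisfying $b$, and the other constructs have their usual meaning. For $i\in\mathbb{N}$ let $\mathcal{V}_i=\{x_i:x\in\mathcal{V}\}$; a program over $\mathcal{V}_i$ uses only variables from $\mathcal{V}_i$. For states with disjoint domains, $\sigma_1\oplus\sigma_2$ is the combined state. Assertions are first-order formulas interpreted over states. FEHT validity. $\langle\Phi\rangle\,\mathbb{P}_1\circledast\cdots\circledast\mathbb{P}_k\sim\mathbb{P}_{k+1}\circledast\cdots\circledast\mathbb{P}_{k+l}\,\langle\Psi\rangle$ is valid if for all states $\sigma_1,\dots,\sigma_{k+l}$ (domains $\mathcal{V}_1,\dots,\mathcal{V}_{k+l}$) and $\sigma'_1,\dots,\sigma'_k$ with $\bigoplus_{i=1}^{k+l}\sigma_i\models\Phi$ and $[\![\mathbb{P}_i]\!](\sigma_i,\sigma'_i)$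 for $i\in[1,k]$, there exist $\sigma'_{k+1},\dots,\sigma'_{k+l}$ with $[\![\mathbb{P}_i]\!](\sigma_i,\sigma'_i)$ for $i\in[k+1,k+l]$ and $\bigoplus_{i=1}^{k+l}\sigma'_i\models\Psi$. Parametric assertions. Let $\mathfrak{P}=\{\mu_1,\dots,\mu_n\}$ be a set of parameters (fresh variables ranging over $\mathbb{Z}$). A parametric assertion is a pair $(\Xi,\mathcal{C})$ with $\Xi$ a formula over $\bigcup_{i=1}^{k+l}\mathcal{V}_i\cup\mathfrak{P}$ and $\mathcal{C}$ a formula over $\mathfrak{P}$. For a parameter evaluation $\kappa:\mathfrak{P}\to\mathbb{Z}$, $\Xi[\kappa]$ is the formula over $\bigcup_{i=1}^{k+l}\mathcal{V}_i$ obtained by fixing each parameter to its $\kappa$-value. $(\Xi,\mathcal{C})$ is a parametric postcondition for $(\Phi,\mathbb{P}_1,\dots,\mathbb{P}_{k+l})$ if for all states $\sigma_1,\dots,\sigma_{k+l},\sigma'_1,\dots,\sigma'_k$ with $\bigoplus_{i=1}^{k+l}\sigma_i\models\Phi$ and $[\![\mathbb{P}_i]\!](\sigma_i,\sigma'_i)$ for all $i\in[1,k]$, and every $\kappa$ with $\kappa\models\mathcal{C}$: (1) there exist states $\sigma'_{k+1},\dots,\sigma'_{k+l}$ with $\bigoplus_{i=1}^{k+l}\sigma'_i\models\Xi[\kappa]$, and (2) for all $\sigma'_{k+1},\dots,\sigma'_{k+l}$ with $\bigoplus_{i=1}^{k+l}\sigma'_i\models\Xi[\kappa]$ we have $[\![\mathbb{P}_i]\!](\sigma_i,\sigma'_i)$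 for all $i\in[k+1,k+l]$. *)

theory Defs
  imports Main
begin

text \<open>\<^term>\<open>Ix x i\<close> is the copy $x_i$ of the program variable $x$; \<^term>\<open>Par j\<close> is the parameter $\mu_j$.\<close>

datatype 'v var = Ix 'v nat | Par nat

definition vars_copy :: "'v set \<Rightarrow> nat \<Rightarrow> 'v var set" where
  "vars_copy V i = {Ix x i | x. x \<in> V}"

definition params :: "nat \<Rightarrow> 'v var set" where
  "params n = Par ` {1..n}"

text \<open>A state with domain \<open>D\<close> is a partial map \<open>s\<close> with \<open>dom s = D\<close>; parameter evaluations are
  the states with domain \<open>params n\<close>. The value of a variable outside the domain is junk
  (\<open>the None\<close>).\<close>

type_synonym 'x state = "'x \<rightharpoonup> int"

primrec combine :: "(nat \<Rightarrow> 'x state) \<Rightarrow> nat \<Rightarrow> 'x state" where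
  "combine \<sigma> 0 = Map.empty"
| "combine \<sigma> (Suc n) = combine \<sigma> n ++ \<sigma> (Suc n)"

text \<open>Arithmetic operations and relations are symbols of an arbitrary first-order signature,
  interpreted over the integers. Integer literals are always available.\<close>

record ('f, 'p) interp =
  fn :: "'f \<Rightarrow> int list \<Rightarrow> int"
  rel :: "'p \<Rightarrow> int list \<Rightarrow> bool"

datatype ('f, 'x) trm = Var 'x | Const int | App 'f "('f, 'x) trm list"

primrec tval :: "('f, 'p) interp \<Rightarrow> 'x state \<Rightarrow> ('f, 'x) trm \<Rightarrow> int" where
  "tval I s (Var x) = the (s x)"
| "tval I s (Const c) = c"
| "tval I s (App f ts) = fn I f (map (tval I s) ts)"

primrec tvars :: "('f, 'x) trm \<Rightarrow> 'x set" where
  "tvars (Var x) = {x}"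
| "tvars (Const c) = {}"
| "tvars (App f ts) = \<Union> (set (map tvars ts))"

datatype ('f, 'p, 'x) bexp =
    BTrue
  | BEq "('f, 'x) trm" "('f, 'x) trm"
  | BRel 'p "('f, 'x) trm list"
  | BNot "('f, 'p, 'x) bexp"
  | BAnd "('f, 'p, 'x) bexp" "('f, 'p, 'x) bexp"
  | BOr "('f, 'p, 'x) bexp" "('f, 'p, 'x) bexp"

primrec bval :: "('f, 'p) interp \<Rightarrow> 'x state \<Rightarrow> ('f, 'p, 'x) bexp \<Rightarrow> bool" where
  "bval I s BTrue \<longleftrightarrow> True"
| "bval I s (BEq t u) \<longleftrightarrow> tval I s t = tval I s u"
| "bval I s (BRel p ts) \<longleftrightarrow> rel I p (map (tval I s) ts)"
| "bval I s (BNot b) \<longleftrightarrow> \<not> bval I s b"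
| "bval I s (BAnd a b) \<longleftrightarrow> bval I s a \<and> bval I s b"
| "bval I s (BOr a b) \<longleftrightarrow> bval I s a \<or> bval I s b"

primrec bvars :: "('f, 'p, 'x) bexp \<Rightarrow> 'x set" where
  "bvars BTrue = {}"
| "bvars (BEq t u) = tvars t \<union> tvars u"
| "bvars (BRel p ts) = \<Union> (set (map tvars ts))"
| "bvars (BNot b) = bvars b"
| "bvars (BAnd a b) = bvars a \<union> bvars b"
| "bvars (BOr a b) = bvars a \<union> bvars b"

datatype ('f, 'p, 'x) prog =
    Skip
  | Assign 'x "('f, 'x) trm"
  | Assume "('f, 'p, 'x) bexp"
  | If "('f, 'p, 'x) bexp" "('f, 'p, 'x) prog" "('f, 'p, 'x) prog"
  | While "('f, 'p, 'x) bexp" "('f, 'p, 'x) prog"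
  | Seq "('f, 'p, 'x) prog" "('f, 'p, 'x) prog"
  | Havoc 'x

primrec pvars :: "('f, 'p, 'x) prog \<Rightarrow> 'x set" where
  "pvars Skip = {}"
| "pvars (Assign x e) = insert x (tvars e)"
| "pvars (Assume b) = bvars b"
| "pvars (If b P Q) = bvars b \<union> pvars P \<union> pvars Q"
| "pvars (While b P) = bvars b \<union> pvars P"
| "pvars (Seq P Q) = pvars P \<union> pvars Q"
| "pvars (Havoc x) = {x}"

inductive exec :: "('f, 'p) interp \<Rightarrow> ('f, 'p, 'x) prog \<Rightarrow> 'x state \<Rightarrow> 'x state \<Rightarrow> bool"
  for I :: "('f, 'p) interp" where
  Skip: "exec I Skip s s"
| Assign: "exec I (Assign x e) s (s(x \<mapsto> tval I s e))"
| Assume: "bval I s b \<Longrightarrow> exec I (Assume b) s s"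
| IfTrue: "bval I s b \<Longrightarrow> exec I P s s' \<Longrightarrow> exec I (If b P Q) s s'"
| IfFalse: "\<not> bval I s b \<Longrightarrow> exec I Q s s' \<Longrightarrow> exec I (If b P Q) s s'"
| WhileFalse: "\<not> bval I s b \<Longrightarrow> exec I (While b P) s s"
| WhileTrue: "bval I s b \<Longrightarrow> exec I P s s' \<Longrightarrow> exec I (While b P) s' s'' \<Longrightarrow> exec I (While b P) s s''"
| Seq: "exec I P s s' \<Longrightarrow> exec I Q s' s'' \<Longrightarrow> exec I (Seq P Q) s s''"
| Havoc: "exec I (Havoc x) s (s(x \<mapsto> c))"

datatype ('f, 'p, 'x) fm =
    FTrue
  | FEq "('f, 'x) trm" "('f, 'x) trm"
  | FRel 'p "('f, 'x) trm list"
  | FNot "('f, 'p, 'x) fm"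
  | FAnd "('f, 'p, 'x) fm" "('f, 'p, 'x) fm"
  | FOr "('f, 'p, 'x) fm" "('f, 'p, 'x) fm"
  | FImp "('f, 'p, 'x) fm" "('f, 'p, 'x) fm"
  | FAll 'x "('f, 'p, 'x) fm"
  | FEx 'x "('f, 'p, 'x) fm"

primrec sat :: "('f, 'p) interp \<Rightarrow> ('f, 'p, 'x) fm \<Rightarrow> 'x state \<Rightarrow> bool" where
  "sat I FTrue s \<longleftrightarrow> True"
| "sat I (FEq t u) s \<longleftrightarrow> tval I s t = tval I s u"
| "sat I (FRel p ts) s \<longleftrightarrow> rel I p (map (tval I s) ts)"
| "sat I (FNot \<phi>) s \<longleftrightarrow> \<not> sat I \<phi> s"
| "sat I (FAnd \<phi> \<psi>) s \<longleftrightarrow> sat I \<phi> s \<and> sat I \<psi> s"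
| "sat I (FOr \<phi> \<psi>) s \<longleftrightarrow> sat I \<phi> s \<or> sat I \<psi> s"
| "sat I (FImp \<phi> \<psi>) s \<longleftrightarrow> (sat I \<phi> s \<longrightarrow> sat I \<psi> s)"
| "sat I (FAll x \<phi>) s \<longleftrightarrow> (\<forall>c. sat I \<phi> (s(x \<mapsto> c)))"
| "sat I (FEx x \<phi>) s \<longleftrightarrow> (\<exists>c. sat I \<phi> (s(x \<mapsto> c)))"

primrec fv :: "('f, 'p, 'x) fm \<Rightarrow> 'x set" where
  "fv FTrue = {}"
| "fv (FEq t u) = tvars t \<union> tvars u"
| "fv (FRel p ts) = \<Union> (set (map tvars ts))"
| "fv (FNot \<phi>) = fv \<phi>"
| "fv (FAnd \<phi> \<psi>) = fv \<phi> \<union> fv \<psi>"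
| "fv (FOr \<phi> \<psi>) = fv \<phi> \<union> fv \<psi>"
| "fv (FImp \<phi> \<psi>) = fv \<phi> \<union> fv \<psi>"
| "fv (FAll x \<phi>) = fv \<phi> - {x}"
| "fv (FEx x \<phi>) = fv \<phi> - {x}"

text \<open>The formula $\Xi[\kappa]$: free occurrences of variables in the domain of $\kappa$ are replaced
  by integer literals, so no capture can arise.\<close>

primrec tinst :: "'x state \<Rightarrow> ('f, 'x) trm \<Rightarrow> ('f, 'x) trm" where
  "tinst \<kappa> (Var x) = (case \<kappa> x of None \<Rightarrow> Var x | Some c \<Rightarrow> Const c)"
| "tinst \<kappa> (Const c) = Const c"
| "tinst \<kappa> (App f ts) = App f (map (tinst \<kappa>) ts)"

primrec finst :: "('f, 'p, 'x) fm \<Rightarrow> 'x state \<Rightarrow> ('f, 'p, 'x) fm" where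
  "finst FTrue \<kappa> = FTrue"
| "finst (FEq t u) \<kappa> = FEq (tinst \<kappa> t) (tinst \<kappa> u)"
| "finst (FRel p ts) \<kappa> = FRel p (map (tinst \<kappa>) ts)"
| "finst (FNot \<phi>) \<kappa> = FNot (finst \<phi> \<kappa>)"
| "finst (FAnd \<phi> \<psi>) \<kappa> = FAnd (finst \<phi> \<kappa>) (finst \<psi> \<kappa>)"
| "finst (FOr \<phi> \<psi>) \<kappa> = FOr (finst \<phi> \<kappa>) (finst \<psi> \<kappa>)"
| "finst (FImp \<phi> \<psi>) \<kappa> = FImp (finst \<phi> \<kappa>) (finst \<psi> \<kappa>)"
| "finst (FAll x \<phi>) \<kappa> = FAll x (finst \<phi> (\<kappa>(x := None)))"
| "finst (FEx x \<phi>) \<kappa> = FEx x (finst \<phi> (\<kappa>(x := None)))"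

text \<open>The quantifier blocks $\forall_{x \in X} x.$ and $\exists_{x \in X} x.$ are given by their
  meaning, because the set of program variables, and hence \<open>X\<close>, may be infinite. For finite
  \<open>X\<close> they are iterated first-order quantifiers.\<close>

definition all_block :: "'x set \<Rightarrow> ('x state \<Rightarrow> bool) \<Rightarrow> 'x state \<Rightarrow> bool" where
  "all_block X A s \<longleftrightarrow> (\<forall>t. dom t = X \<longrightarrow> A (s ++ t))"

definition ex_block :: "'x set \<Rightarrow> ('x state \<Rightarrow> bool) \<Rightarrow> 'x state \<Rightarrow> bool" where
  "ex_block X A s \<longleftrightarrow> (\<exists>t. dom t = X \<and> A (s ++ t))"

lemma all_block_insert:
  "all_block (insert x X) A s \<longleftrightarrow> (\<forall>c. all_block X A (s(x \<mapsto> c)))"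
proof
  assume L: "all_block (insert x X) A s"
  show "\<forall>c. all_block X A (s(x \<mapsto> c))"
  proof (intro allI, unfold all_block_def, intro allI impI)
    fix c and t :: "'a state" assume "dom t = X"
    then have "dom ([x \<mapsto> c] ++ t) = insert x X" by auto
    with L have "A (s ++ ([x \<mapsto> c] ++ t))" unfolding all_block_def by blast
    then show "A (s(x \<mapsto> c) ++ t)" by simp
  qed
next
  assume R: "\<forall>c. all_block X A (s(x \<mapsto> c))"
  show "all_block (insert x X) A s"
    unfolding all_block_def
  proof (intro allI impI)
    fix t :: "'a state" assume d: "dom t = insert x X"
    then obtain c where c: "t x = Some c" by blast
    have "dom (t |` X) = X" using d by auto
    with R have "A (s(x \<mapsto> c) ++ (t |` X))" unfolding all_block_def by blast
    moreover have "s(x \<mapsto> c) ++ (t |` X) = s ++ t"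
    proof
      fix y
      show "(s(x \<mapsto> c) ++ (t |` X)) y = (s ++ t) y"
        using d c by (cases "y \<in> X"; cases "y = x"; cases "t y")
          (auto simp: map_add_def restrict_map_def split: option.splits)
    qed
    ultimately show "A (s ++ t)" by simp
  qed
qed

lemma ex_block_iff_not_all: "ex_block X A s \<longleftrightarrow> \<not> all_block X (\<lambda>t. \<not> A t) s"
  by (simp add: ex_block_def all_block_def)

lemma all_block_iterated: "all_block (set xs) (sat I \<phi>) s \<longleftrightarrow> sat I (foldr FAll xs \<phi>) s"
  by (induction xs arbitrary: s) (simp_all add: all_block_insert, simp add: all_block_def)

lemma ex_block_iterated: "ex_block (set xs) (sat I \<phi>) s \<longleftrightarrow> sat I (foldr FEx xs \<phi>) s"
  by (induction xs arbitrary: s)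
    (simp_all add: ex_block_iff_not_all all_block_insert, simp add: all_block_def)

text \<open>In the following definitions \<open>\<sigma>\<close> holds the initial states, \<open>\<sigma>'\<close> the final states with
  index in \<open>{1..k}\<close> and \<open>\<tau>\<close> those with index in \<open>{k+1..k+l}\<close>; values at other indices are
  never used.\<close>

definition final :: "nat \<Rightarrow> (nat \<Rightarrow> 'x state) \<Rightarrow> (nat \<Rightarrow> 'x state) \<Rightarrow> nat \<Rightarrow> 'x state" where
  "final k \<sigma>' \<tau> i = (if i \<le> k then \<sigma>' i else \<tau> i)"

definition feht_valid :: "('f, 'p) interp \<Rightarrow> 'v set \<Rightarrow> nat \<Rightarrow> nat \<Rightarrow> ('f, 'p, 'v var) fm \<Rightarrow>
    (nat \<Rightarrow> ('f, 'p, 'v var) prog) \<Rightarrow> ('f, 'p, 'v var) fm \<Rightarrow> bool" where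
  "feht_valid I V k l \<Phi> P \<Psi> \<longleftrightarrow>
    (\<forall>\<sigma> \<sigma>'. (\<forall>i\<in>{1..k+l}. dom (\<sigma> i) = vars_copy V i) \<and>
            (\<forall>i\<in>{1..k}. dom (\<sigma>' i) = vars_copy V i) \<and>
            sat I \<Phi> (combine \<sigma> (k + l)) \<and>
            (\<forall>i\<in>{1..k}. exec I (P i) (\<sigma> i) (\<sigma>' i)) \<longrightarrow>
      (\<exists>\<tau>. (\<forall>i\<in>{k+1..k+l}. dom (\<tau> i) = vars_copy V i) \<and>
           (\<forall>i\<in>{k+1..k+l}. exec I (P i) (\<sigma> i) (\<tau> i)) \<and>
           sat I \<Psi> (combine (final k \<sigma>' \<tau>) (k + l))))"

definition parametric_assertion :: "'v set \<Rightarrow> nat \<Rightarrow> nat \<Rightarrow>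
    ('f, 'p, 'v var) fm \<times> ('f, 'p, 'v var) fm \<Rightarrow> bool" where
  "parametric_assertion V m n = (\<lambda>(\<Xi>, C).
    fv \<Xi> \<subseteq> (\<Union>i\<in>{1..m}. vars_copy V i) \<union> params n \<and> fv C \<subseteq> params n)"

definition parametric_postcondition :: "('f, 'p) interp \<Rightarrow> 'v set \<Rightarrow> nat \<Rightarrow> nat \<Rightarrow> nat \<Rightarrow>
    ('f, 'p, 'v var) fm \<Rightarrow> (nat \<Rightarrow> ('f, 'p, 'v var) prog) \<Rightarrow>
    ('f, 'p, 'v var) fm \<times> ('f, 'p, 'v var) fm \<Rightarrow> bool" where
  "parametric_postcondition I V k l n \<Phi> P = (\<lambda>(\<Xi>, C).
    parametric_assertion V (k + l) n (\<Xi>, C) \<and>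
    (\<forall>\<sigma> \<sigma>' \<kappa>. (\<forall>i\<in>{1..k+l}. dom (\<sigma> i) = vars_copy V i) \<and>
              (\<forall>i\<in>{1..k}. dom (\<sigma>' i) = vars_copy V i) \<and>
              sat I \<Phi> (combine \<sigma> (k + l)) \<and>
              (\<forall>i\<in>{1..k}. exec I (P i) (\<sigma> i) (\<sigma>' i)) \<and>
              dom \<kappa> = params n \<and> sat I C \<kappa> \<longrightarrow>
      (\<exists>\<tau>. (\<forall>i\<in>{k+1..k+l}. dom (\<tau> i) = vars_copy V i) \<and>
           sat I (finst \<Xi> \<kappa>) (combine (final k \<sigma>' \<tau>) (k + l))) \<and>
      (\<forall>\<tau>. (\<forall>i\<in>{k+1..k+l}. dom (\<tau> i) = vars_copy V i) \<and>
           sat I (finst \<Xi> \<kappa>) (combine (final k \<sigma>' \<tau>) (k + l)) \<longrightarrow>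
           (\<forall>i\<in>{k+1..k+l}. exec I (P i) (\<sigma> i) (\<tau> i)))))"

end

(* The final states of P_1, ..., P_k instantiate the outer universal block, and the existential block
   then yields a parameter evaluation \<kappa> satisfying C. For this \<kappa>, the parametric postcondition
   provides final states of the remaining programs that satisfy \<Xi>[\<kappa>], and all such states are
   reachable; the inner universal block turns \<Xi>[\<kappa>] into \<Psi>. *)

theory Submission
  imports Defs
begin

lemma tval_cong: "(\<And>x. x \<in> tvars t \<Longrightarrow> s x = s' x) \<Longrightarrow> tval I s t = tval I s' t"
proof (induction t)
  case (App f ts)
  have "map (tval I s) ts = map (tval I s') ts"
    using App.prems by (intro map_cong refl App.IH) auto
  then show ?case by (simp only: tval.simps)
qed simp_all

lemma sat_cong: "(\<And>x. x \<in> fv \<phi> \<Longrightarrow> s x = s' x) \<Longrightarrow> sat I \<phi> s \<longleftrightarrow> sat I \<phi> s'"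
proof (induction \<phi> arbitrary: s s')
  case (FEq t u)
  then show ?case using tval_cong[of t s s' I] tval_cong[of u s s' I] by simp
next
  case (FRel p ts)
  then have "map (tval I s) ts = map (tval I s') ts"
    by (auto intro!: tval_cong)
  then show ?case by (simp only: sat.simps)
next
  case (FNot \<phi>)
  show ?case using FNot.IH[of s s'] FNot.prems by simp
next
  case (FAnd \<phi> \<psi>)
  show ?case using FAnd.IH[of s s'] FAnd.prems by simp
next
  case (FOr \<phi> \<psi>)
  show ?case using FOr.IH[of s s'] FOr.prems by simp
next
  case (FImp \<phi> \<psi>)
  show ?case using FImp.IH[of s s'] FImp.prems by simp
next
  case (FAll x \<phi>)
  have "sat I \<phi> (s(x \<mapsto> c)) \<longleftrightarrow> sat I \<phi> (s'(x \<mapsto> c))" for c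
    using FAll.prems by (intro FAll.IH) auto
  then show ?case by simp
next
  case (FEx x \<phi>)
  have "sat I \<phi> (s(x \<mapsto> c)) \<longleftrightarrow> sat I \<phi> (s'(x \<mapsto> c))" for c
    using FEx.prems by (intro FEx.IH) auto
  then show ?case by simp
qed simp

lemma sat_map_add_if_fv_subset_dom: "fv \<phi> \<subseteq> dom t \<Longrightarrow> sat I \<phi> (s ++ t) \<longleftrightarrow> sat I \<phi> t"
  by (rule sat_cong) (auto simp: map_add_dom_app_simps)

lemma sat_map_add_if_fv_disjoint_dom: "fv \<phi> \<inter> dom t = {} \<Longrightarrow> sat I \<phi> (s ++ t) \<longleftrightarrow> sat I \<phi> s"
  by (rule sat_cong) (auto simp: map_add_dom_app_simps disjoint_iff)

lemma tval_tinst: "tval I s (tinst \<kappa> t) = tval I (s ++ \<kappa>) t"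
  by (induction t) (auto simp: map_add_def comp_def cong: map_cong split: option.splits)

lemma map_upd_map_add_remove: "s(x \<mapsto> c) ++ \<kappa>(x := None) = (s ++ \<kappa>)(x \<mapsto> c)"
  by (rule ext) (simp add: map_add_def split: option.split)

lemma sat_finst: "sat I (finst \<phi> \<kappa>) s \<longleftrightarrow> sat I \<phi> (s ++ \<kappa>)"
  by (induction \<phi> arbitrary: s \<kappa>)
    (simp_all add: tval_tinst comp_def map_upd_map_add_remove)

lemma all_blockD: "all_block X A s \<Longrightarrow> dom t = X \<Longrightarrow> A (s ++ t)"
  by (simp add: all_block_def)

lemma all_ex_all_blockE:
  assumes closed: "all_block X (ex_block M (\<lambda>s. sat I C s \<and>
      all_block Y (sat I (FImp \<Xi> \<Psi>)) s)) Map.empty"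
    and C_over: "fv C \<subseteq> M" and \<Psi>_disjoint: "fv \<Psi> \<inter> M = {}" and Y_disjoint: "M \<inter> Y = {}"
    and dom_s: "dom s = X"
  obtains \<kappa> where "dom \<kappa> = M" and "sat I C \<kappa>"
    and "\<forall>t. dom t = Y \<longrightarrow> sat I (finst \<Xi> \<kappa>) (s ++ t) \<longrightarrow> sat I \<Psi> (s ++ t)"
proof -
  obtain \<kappa> where dom_\<kappa>: "dom \<kappa> = M" and C: "sat I C (s ++ \<kappa>)"
    and imp: "all_block Y (sat I (FImp \<Xi> \<Psi>)) (s ++ \<kappa>)"
    using all_blockD[OF closed dom_s] unfolding ex_block_def empty_map_add by blast
  have "sat I C \<kappa>"
    using C C_over dom_\<kappa> by (simp add: sat_map_add_if_fv_subset_dom)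
  moreover have "sat I \<Psi> (s ++ t)" if dom_t: "dom t = Y" and \<Xi>: "sat I (finst \<Xi> \<kappa>) (s ++ t)" for t
  proof -
    have "\<kappa> ++ t = t ++ \<kappa>"
      using Y_disjoint dom_\<kappa> dom_t by (intro map_add_comm) simp
    then have "sat I (FImp \<Xi> \<Psi>) (s ++ t ++ \<kappa>)"
      using all_blockD[OF imp dom_t] by (simp flip: map_add_assoc)
    then have "sat I \<Psi> (s ++ t ++ \<kappa>)"
      using \<Xi> by (simp add: sat_finst)
    then show ?thesis
      using \<Psi>_disjoint dom_\<kappa> by (simp add: sat_map_add_if_fv_disjoint_dom)
  qed
  ultimately show thesis
    using dom_\<kappa> that by blast
qed

lemma dom_combine: "dom (combine \<sigma> m) = (\<Union>i\<in>{1..m}. dom (\<sigma> i))"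
  by (induction m) (auto simp: atLeastAtMostSuc_conv)

lemma dom_combine_shift: "dom (combine (\<lambda>i. \<sigma> (k + i)) l) = (\<Union>i\<in>{k+1..k+l}. dom (\<sigma> i))"
proof -
  have "{k+1..k+l} = (+) k ` {1..l}"
    by simp
  then show ?thesis
    by (simp only: dom_combine image_image)
qed

lemma combine_cong: "(\<And>i. i \<in> {1..m} \<Longrightarrow> \<sigma> i = \<tau> i) \<Longrightarrow> combine \<sigma> m = combine \<tau> m"
  by (induction m) simp_all

lemma combine_add: "combine \<sigma> (k + l) = combine \<sigma> k ++ combine (\<lambda>i. \<sigma> (k + i)) l"
  by (induction l) simp_all

lemma combine_final:
  "combine (final k \<sigma>' \<tau>) (k + l) = combine \<sigma>' k ++ combine (\<lambda>i. \<tau> (k + i)) l"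
proof -
  have "combine (final k \<sigma>' \<tau>) k = combine \<sigma>' k"
    by (rule combine_cong) (simp add: final_def)
  moreover have "combine (\<lambda>i. final k \<sigma>' \<tau> (k + i)) l = combine (\<lambda>i. \<tau> (k + i)) l"
    by (rule combine_cong) (simp add: final_def)
  ultimately show ?thesis
    by (simp add: combine_add)
qed

lemma params_disjoint_vars_copies: "params n \<inter> (\<Union>i\<in>J. vars_copy V i) = {}"
  by (auto simp: params_def vars_copy_def)

abbreviation states_over :: "'v set \<Rightarrow> nat set \<Rightarrow> (nat \<Rightarrow> 'v var state) \<Rightarrow> bool" where
  "states_over V J \<sigma> \<equiv> \<forall>i\<in>J. dom (\<sigma> i) = vars_copy V i"

abbreviation exec_all :: "('f, 'p) interp \<Rightarrow> nat set \<Rightarrow> (nat \<Rightarrow> ('f, 'p, 'x) prog) \<Rightarrow>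
    (nat \<Rightarrow> 'x state) \<Rightarrow> (nat \<Rightarrow> 'x state) \<Rightarrow> bool" where
  "exec_all I J P \<sigma> \<sigma>' \<equiv> \<forall>i\<in>J. exec I (P i) (\<sigma> i) (\<sigma>' i)"

lemma feht_validI:
  assumes "\<And>\<sigma> \<sigma>'. \<lbrakk>states_over V {1..k+l} \<sigma>; states_over V {1..k} \<sigma>';
      sat I \<Phi> (combine \<sigma> (k + l)); exec_all I {1..k} P \<sigma> \<sigma>'\<rbrakk> \<Longrightarrow>
    \<exists>\<tau>. states_over V {k+1..k+l} \<tau> \<and> exec_all I {k+1..k+l} P \<sigma> \<tau> \<and>
      sat I \<Psi> (combine (final k \<sigma>' \<tau>) (k + l))"
  shows "feht_valid I V k l \<Phi> P \<Psi>"
  unfolding feht_valid_def by (intro allI impI, elim conjE) (rule assms)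

lemma parametric_postconditionE:
  assumes "parametric_postcondition I V k l n \<Phi> P (\<Xi>, C)"
    and "states_over V {1..k+l} \<sigma>" and "states_over V {1..k} \<sigma>'"
    and "sat I \<Phi> (combine \<sigma> (k + l))" and "exec_all I {1..k} P \<sigma> \<sigma>'"
    and "dom \<kappa> = params n" and "sat I C \<kappa>"
  obtains \<tau> where "states_over V {k+1..k+l} \<tau>" and "exec_all I {k+1..k+l} P \<sigma> \<tau>"
    and "sat I (finst \<Xi> \<kappa>) (combine (final k \<sigma>' \<tau>) (k + l))"
proof -
  have "(\<exists>\<tau>. states_over V {k+1..k+l} \<tau> \<and> sat I (finst \<Xi> \<kappa>) (combine (final k \<sigma>' \<tau>) (k + l))) \<and>
      (\<forall>\<tau>. states_over V {k+1..k+l} \<tau> \<and> sat I (finst \<Xi> \<kappa>) (combine (final k \<sigma>' \<tau>) (k + l)) \<longrightarrow>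
        exec_all I {k+1..k+l} P \<sigma> \<tau>)"
    using assms(1)[unfolded parametric_postcondition_def prod.case, THEN conjunct2,
      THEN spec, THEN spec, THEN spec, THEN mp, of \<sigma> \<sigma>' \<kappa>] assms(2-) by argo
  with that show thesis
    by blast
qed

theorem theorem3:
  fixes I :: "('f, 'p) interp" and V :: "'v set" and k l n :: nat
    and \<Phi> \<Psi> \<Xi> C :: "('f, 'p, 'v var) fm"
    and P :: "nat \<Rightarrow> ('f, 'p, 'v var) prog"
  assumes "fv \<Phi> \<subseteq> (\<Union>i\<in>{1..k+l}. vars_copy V i)"
    and "fv \<Psi> \<subseteq> (\<Union>i\<in>{1..k+l}. vars_copy V i)"
    and "\<And>i. i \<in> {1..k+l} \<Longrightarrow> pvars (P i) \<subseteq> vars_copy V i"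
    and "parametric_postcondition I V k l n \<Phi> P (\<Xi>, C)"
    and "all_block (\<Union>i\<in>{1..k}. vars_copy V i)
           (ex_block (params n)
             (\<lambda>s. sat I C s \<and>
                  all_block (\<Union>i\<in>{k+1..k+l}. vars_copy V i) (sat I (FImp \<Xi> \<Psi>)) s))
           Map.empty"
  shows "feht_valid I V k l \<Phi> P \<Psi>"
proof (rule feht_validI)
  fix \<sigma> \<sigma>' :: "nat \<Rightarrow> 'v var state"
  assume init: "states_over V {1..k+l} \<sigma>" "states_over V {1..k} \<sigma>'"
      "sat I \<Phi> (combine \<sigma> (k + l))" "exec_all I {1..k} P \<sigma> \<sigma>'"
  have C_over: "fv C \<subseteq> params n"
    using assms(4) by (simp add: parametric_postcondition_def parametric_assertion_def)
  have \<Psi>_disjoint: "fv \<Psi> \<inter> params n = {}"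
    using assms(2) params_disjoint_vars_copies by blast
  have dom_\<sigma>': "dom (combine \<sigma>' k) = (\<Union>i\<in>{1..k}. vars_copy V i)"
    using init(2) by (simp add: dom_combine)
  obtain \<kappa> where \<kappa>: "dom \<kappa> = params n" "sat I C \<kappa>"
    and \<Xi>_imp_\<Psi>: "\<forall>t. dom t = (\<Union>i\<in>{k+1..k+l}. vars_copy V i) \<longrightarrow>
      sat I (finst \<Xi> \<kappa>) (combine \<sigma>' k ++ t) \<longrightarrow> sat I \<Psi> (combine \<sigma>' k ++ t)"
    using all_ex_all_blockE[OF assms(5) C_over \<Psi>_disjoint params_disjoint_vars_copies dom_\<sigma>'] .
  obtain \<tau> where \<tau>: "states_over V {k+1..k+l} \<tau>" "exec_all I {k+1..k+l} P \<sigma> \<tau>"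
    and \<Xi>: "sat I (finst \<Xi> \<kappa>) (combine (final k \<sigma>' \<tau>) (k + l))"
    using parametric_postconditionE[OF assms(4) init \<kappa>] .
  have "sat I \<Psi> (combine (final k \<sigma>' \<tau>) (k + l))"
    using \<Xi>_imp_\<Psi> \<Xi> \<tau>(1) by (simp add: combine_final dom_combine_shift)
  with \<tau> show "\<exists>\<tau>. states_over V {k+1..k+l} \<tau> \<and> exec_all I {k+1..k+l} P \<sigma> \<tau> \<and>
      sat I \<Psi> (combine (final k \<sigma>' \<tau>) (k + l))"
    by blast
qed

end
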